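(* Let $V_1, V_2$ be positive integers and let $(V_m)_{m\ge 1}$ satisfy $V_m=V_{m-1}+V_{m-2}$ for $m\ge 3$. Let $n,d$ be positive integers and let $S=\langle V_n,V_{n+d},V_{n+2d},\ldots\rangle$. Then $S$ is a numerical semigroup if and only if $\gcd(V_1,V_2)=1$ and $\gcd(V_n,F_d)=1$.
   Context: For a set $A$ of positive integers, $\langle A\rangle$ denotes the set of all finite linear combinations of elements of $A$ with non-negative integer coefficients. $\langle A\rangle$ is called a numerical semigroup if $\gcd(A)=1$ (equivalently, if $\mathbb{Z}_{\ge 0}\setminus\langle A\rangle$ is finite). $F_m$ denotes the Fibonacci sequence: $F_0=0$, $F_1=F_2=1$, $F_m=F_{m-1}+F_{m-2}$. *)

theory Defs
  imports "HOL-Number_Theory.Fib"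
begin

definition nat_span :: "nat set \<Rightarrow> nat set" where
  "nat_span A = {(\<Sum>a\<in>B. c a * a) | B c. finite B \<and> B \<subseteq> A}"

(* A property of the set S itself, not of a chosen generating set. The choice of A is
   immaterial because Gcd (nat_span A) = Gcd A. Since Gcd {} = 0, A is nonempty. *)
definition numerical_semigroup :: "nat set \<Rightarrow> bool" where
  "numerical_semigroup S \<longleftrightarrow> (\<exists>A. (\<forall>a\<in>A. a > 0) \<and> S = nat_span A \<and> Gcd A = 1)"

end

theory Submission
  imports Defs
begin

text \<open>
  A semigroup generated by \<open>A\<close> determines \<open>Gcd A\<close>, so the question is when the numbers
  \<open>V (n + k * d)\<close> have greatest common divisor 1. Now
  \<open>V (n + m) = fib m * V (n + 1) + fib (m - 1) * V n\<close>, and \<open>fib d\<close> divides \<open>fib (k * d)\<close>.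
  Hence \<open>gcd (V n) (fib d)\<close> divides every generator, as does \<open>gcd (V 1) (V 2)\<close>. Conversely
  \<open>gcd (V n) (V (n + d)) = gcd (V n) (fib d * V (n + 1))\<close>, where \<open>V n\<close> and \<open>V (n + 1)\<close>
  are coprime if \<open>V 1\<close> and \<open>V 2\<close> are.
\<close>

lemma Gcd_nat_span: "Gcd (nat_span A) = Gcd A"
proof (rule dvd_antisym)
  have "A \<subseteq> nat_span A"
  proof
    fix a assume "a \<in> A"
    then show "a \<in> nat_span A"
      unfolding nat_span_def
      by (intro CollectI exI[of _ "{a}"] exI[of _ "\<lambda>_. 1"]) simp
  qed
  then show "Gcd (nat_span A) dvd Gcd A"
    by (meson Gcd_dvd Gcd_greatest subsetD)
  show "Gcd A dvd Gcd (nat_span A)"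
    unfolding nat_span_def by (fastforce intro: Gcd_greatest dvd_sum dvd_mult)
qed

text \<open>The definition asks only for some generating set; since the span fixes
  \<open>Gcd\<close>, the given \<open>A\<close> decides.\<close>

lemma numerical_semigroup_nat_span_iff:
  assumes "\<And>a. a \<in> A \<Longrightarrow> a > 0"
  shows "numerical_semigroup (nat_span A) \<longleftrightarrow> Gcd A = 1"
  using assms unfolding numerical_semigroup_def by (metis Gcd_nat_span)

lemma fib_dvd_fib: "m dvd n \<Longrightarrow> fib m dvd fib n"
  by (metis fib_gcd gcd_nat.absorb_iff1)

locale fibonacci_recurrence =
  fixes V :: "nat \<Rightarrow> nat"
  assumes rec: "m \<ge> 3 \<Longrightarrow> V m = V (m - 1) + V (m - 2)"
begin

lemma rec_Suc: "n > 0 \<Longrightarrow> V (Suc (Suc n)) = V (Suc n) + V n"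
  using rec[of "Suc (Suc n)"] by simp

text \<open>The offset \<open>Suc m\<close> avoids \<open>m - 1\<close>; \<open>n > 0\<close> is
  there because the recurrence says nothing about \<open>V 0\<close>.\<close>

lemma add_Suc_eq:
  assumes "n > 0"
  shows "V (n + Suc m) = fib (Suc m) * V (Suc n) + fib m * V n"
proof (induction m rule: fib.induct)
  case (3 m)
  then show ?case
    using rec_Suc[of "n + Suc m"] by (simp add: algebra_simps)
qed (use assms rec_Suc in auto)

text \<open>By the recurrence, each step up in the index is undone by one Euclidean step.\<close>

lemma gcd_consecutive:
  assumes "n > 0"
  shows "gcd (V n) (V (Suc n)) = gcd (V 1) (V 2)"
  using assms
proof (induction n rule: nat_induct_non_zero)
  case (Suc n)
  then show ?case
    by (simp add: rec_Suc gcd.commute)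
qed (simp add: numeral_2_eq_2)

lemma pos:
  assumes "V 1 > 0" "V 2 > 0" "n > 0"
  shows "V n > 0"
proof -
  have "V n > 0 \<and> V (Suc n) > 0"
    using assms(3)
  proof (induction n rule: nat_induct_non_zero)
    case 1
    then show ?case
      using assms(1,2) by (simp add: numeral_2_eq_2)
  next
    case (Suc n)
    then show ?case
      by (simp add: rec_Suc)
  qed
  then show ?thesis ..
qed

lemma Gcd_progression_eq_1_iff:
  assumes "n > 0" "d > 0"
  shows "Gcd {V (n + k * d) | k. True} = 1 \<longleftrightarrow> gcd (V 1) (V 2) = 1 \<and> gcd (V n) (fib d) = 1"
    (is "Gcd ?A = 1 \<longleftrightarrow> _")
proof
  assume gcd1: "Gcd ?A = 1"
  have common: "g = 1" if "\<And>k. g dvd V (n + k * d)" for g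
  proof -
    have "g dvd Gcd ?A"
      using that by (auto intro!: Gcd_greatest)
    then show ?thesis
      using gcd1 by simp
  qed
  have "gcd (V 1) (V 2) dvd V (n + k * d)" for k
    using gcd_consecutive[of "n + k * d"] assms by (metis add_gr_0 gcd_dvd1)
  moreover have "gcd (V n) (fib d) dvd V (n + k * d)" for k
  \<comment> \<open>At offset 0 the generator is \<open>V n\<close> itself; otherwise
    \<open>add_Suc_eq\<close> applies.\<close>
  proof (cases "k * d")
    case (Suc m)
    have "fib d dvd fib (Suc m)"
      by (metis Suc dvd_triv_right fib_dvd_fib)
    then have "gcd (V n) (fib d) dvd fib (Suc m) * V (Suc n) + fib m * V n"
      by (meson dvd_add dvd_mult dvd_mult2 dvd_trans gcd_dvd1 gcd_dvd2)
    then show ?thesis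
      using Suc add_Suc_eq[OF assms(1), of m] by simp
  qed (simp only: add_0_right gcd_dvd1)
  ultimately show "gcd (V 1) (V 2) = 1 \<and> gcd (V n) (fib d) = 1"
    using common by blast
next
  assume gcds: "gcd (V 1) (V 2) = 1 \<and> gcd (V n) (fib d) = 1"
  obtain m where d: "d = Suc m"
    using assms(2) gr0_implies_Suc by blast
  have "coprime (V n) (fib d)" "coprime (V n) (V (Suc n))"
    using gcds gcd_consecutive[OF assms(1)] by (simp_all only: coprime_iff_gcd_eq_1)
  \<comment> \<open>Modulo \<open>V n\<close> the first summand vanishes, leaving a product of two
    numbers coprime to \<open>V n\<close>.\<close>
  then have "gcd (V n) (fib m * V n + fib d * V (Suc n)) = 1"
    by (simp add: gcd_add_mult)
  moreover have "V (n + d) = fib m * V n + fib d * V (Suc n)"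
    using add_Suc_eq[OF assms(1), of m] d by simp
  ultimately have coprime: "coprime (V n) (V (n + d))"
    by (simp only: coprime_iff_gcd_eq_1)
  have "Gcd ?A dvd V (n + k * d)" for k
    by (rule Gcd_dvd) blast
  \<comment> \<open>The generators for \<open>k = 0\<close> and \<open>k = 1\<close> already have no
    common divisor but 1.\<close>
  from this[of 0] this[of 1] have "Gcd ?A dvd V n" "Gcd ?A dvd V (n + d)"
    by (simp_all only: mult_0 mult_1 add_0_right)
  then show "Gcd ?A = 1"
    using coprime by (metis coprime_common_divisor_nat)
qed

end

theorem theorem2p4:
  fixes V :: "nat \<Rightarrow> nat" and n d :: nat and S :: "nat set"
  assumes "V 1 > 0" and "V 2 > 0"
    and "\<And>m. m \<ge> 3 \<Longrightarrow> V m = V (m - 1) + V (m - 2)"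
    and "n > 0" and "d > 0"
    and "S = nat_span {V (n + k * d) | k. True}"
  shows "numerical_semigroup S \<longleftrightarrow> gcd (V 1) (V 2) = 1 \<and> gcd (V n) (fib d) = 1"
proof -
  interpret fibonacci_recurrence V
    by unfold_locales (fact assms(3))
  have "numerical_semigroup S \<longleftrightarrow> Gcd {V (n + k * d) | k. True} = 1"
    unfolding assms(6) by (rule numerical_semigroup_nat_span_iff) (use pos assms(1,2,4) in auto)
  then show ?thesis
    unfolding Gcd_progression_eq_1_iff[OF assms(4,5)] .
qed

end
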